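(* Let $\Lambda=(\mathcal{L},\mathfrak{M},\models)$ be an eviction-compatible satisfaction system and let $\ominus:\mathcal{P}_{\mathrm{fin}}(\mathcal{L})\times\mathcal{P}(\mathfrak{M})\to\mathcal{P}_{\mathrm{fin}}(\mathcal{L})$ be a model change operation. Then there exists a selection function $\gamma$ on $\Lambda$ such that $\mathrm{Mod}(\ominus(B,\mathbb{M}))=\gamma(\mathrm{FRsubs}(\mathrm{Mod}(B)\setminus\mathbb{M},\Lambda))$ for all $B\in\mathcal{P}_{\mathrm{fin}}(\mathcal{L})$ and $\mathbb{M}\subseteq\mathfrak{M}$ (i.e. $\ominus$ is a maxichoice eviction function) if and only if $\ominus$ satisfies, for all $B,B'\in\mathcal{P}_{\mathrm{fin}}(\mathcal{L})$ and $\mathbb{M},\mathbb{M}'\subseteq\mathfrak{M}$: (success) $\mathbb{M}\cap\mathrm{Mod}(\ominus(B,\mathbb{M}))=\emptyset$; (inclusion) $\mathrm{Mod}(\ominus(B,\mathbb{M}))\subseteq\mathrm{Mod}(B)$; (vacuity) if $\mathbb{M}\cap\mathrm{Mod}(B)=\emptyset$ then $\mathrm{Mod}(\ominus(B,\mathbb{M}))=\mathrm{Mod}(B)$; (finite retainment) if $\mathrm{Mod}(\ominus(B,\mathbb{M}))\subsetneq \mathbb{M}''\subseteq\mathrm{Mod}(B)\setminus\mathbb{M}$ then $\mathbb{M}''\notin\mathrm{FR}(\Lambda)$; (uniformity) if $\mathrm{FRsubs}(\mathrm{Mod}(B)\setminus\mathbb{M},\Lambda)=\mathrm{FRsubs}(\mathrm{Mod}(B')\setminus\mathbb{M}',\Lambda)$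 then $\mathrm{Mod}(\ominus(B,\mathbb{M}))=\mathrm{Mod}(\ominus(B',\mathbb{M}'))$.
   Context: A satisfaction system is a triple $\Lambda=(\mathcal{L},\mathfrak{M},\models)$ where $\mathcal{L}$ is a set of formulae, $\mathfrak{M}$ a set of models, and $\models$ a relation between models and sets of formulae $B\subseteq\mathcal{L}$. $\mathrm{Mod}(B)=\{m\in\mathfrak{M}\mid m\models B\}$. $\mathcal{P}(A)$ is the power set of $A$, $\mathcal{P}_{\mathrm{fin}}(A)$ the set of finite subsets of $A$. $\mathrm{FR}(\Lambda)=\{X\subseteq\mathfrak{M}\mid X=\mathrm{Mod}(B)$ for some $B\in\mathcal{P}_{\mathrm{fin}}(\mathcal{L})\}$. For $\mathbb{M}\subseteq\mathfrak{M}$, $\mathrm{FRsubs}(\mathbb{M},\Lambda)=\{X\in\mathrm{FR}(\Lambda)\mid X\subseteq\mathbb{M}$ and there is no $Y\in\mathrm{FR}(\Lambda)$ with $X\subsetneq Y\subseteq\mathbb{M}\}$. $\Lambda$ is eviction-compatible if $\mathrm{FRsubs}(\mathrm{Mod}(B)\setminus\mathbb{M},\Lambda)\neq\emptyset$ for all $B\in\mathcal{P}_{\mathrm{fin}}(\mathcal{L})$ and $\mathbb{M}\subseteq\mathfrak{M}$. A model change operation is any function $\mathcal{P}_{\mathrm{fin}}(\mathcal{L})\times\mathcal{P}(\mathfrak{M})\to\mathcal{P}_{\mathrm{fin}}(\mathcal{L})$. A selection function on $\Lambda$ is a map $\gamma$ from the nonempty subsets of $\mathrm{FR}(\Lambda)$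 to $\mathrm{FR}(\Lambda)$ with $\gamma(X)\in X$ for every nonempty $X\subseteq\mathrm{FR}(\Lambda)$. *)

theory Defs
  imports "HOL-Library.FuncSet"
begin

(* Carriers are explicit sets rather than whole types, so either may be empty.  A model satisfies
   a whole set of formulae: sat need not be determined by single formulae, nor be antitone.  Values
   of sat outside models \<times> Pow formulae are never used. *)

record ('f, 'm) satisfaction_system =
  formulae :: "'f set"
  models :: "'m set"
  sat :: "'m \<Rightarrow> 'f set \<Rightarrow> bool"

definition Mod :: "('f, 'm) satisfaction_system \<Rightarrow> 'f set \<Rightarrow> 'm set" where
  "Mod \<Lambda> B = {m \<in> models \<Lambda>. sat \<Lambda> m B}"

definition bases :: "('f, 'm) satisfaction_system \<Rightarrow> 'f set set" where
  "bases \<Lambda> = Fpow (formulae \<Lambda>)"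

definition FR :: "('f, 'm) satisfaction_system \<Rightarrow> 'm set set" where
  "FR \<Lambda> = {X. X \<subseteq> models \<Lambda> \<and> (\<exists>B \<in> bases \<Lambda>. X = Mod \<Lambda> B)}"

definition FRsubs :: "'m set \<Rightarrow> ('f, 'm) satisfaction_system \<Rightarrow> 'm set set" where
  "FRsubs M \<Lambda> = {X \<in> FR \<Lambda>. X \<subseteq> M \<and> \<not> (\<exists>Y \<in> FR \<Lambda>. X \<subset> Y \<and> Y \<subseteq> M)}"

definition eviction_compatible :: "('f, 'm) satisfaction_system \<Rightarrow> bool" where
  "eviction_compatible \<Lambda> \<longleftrightarrow>
     (\<forall>B \<in> bases \<Lambda>. \<forall>M \<subseteq> models \<Lambda>. FRsubs (Mod \<Lambda> B - M) \<Lambda> \<noteq> {})"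

(* Maps between carriers are total HOL functions constrained only on their domain; values outside
   it are irrelevant. *)

definition model_change_operation ::
    "('f, 'm) satisfaction_system \<Rightarrow> ('f set \<times> 'm set \<Rightarrow> 'f set) \<Rightarrow> bool" where
  "model_change_operation \<Lambda> ev \<longleftrightarrow> ev \<in> bases \<Lambda> \<times> Pow (models \<Lambda>) \<rightarrow> bases \<Lambda>"

definition selection_function ::
    "('f, 'm) satisfaction_system \<Rightarrow> ('m set set \<Rightarrow> 'm set) \<Rightarrow> bool" where
  "selection_function \<Lambda> \<gamma> \<longleftrightarrow>
     \<gamma> \<in> Pow (FR \<Lambda>) - {{}} \<rightarrow> FR \<Lambda> \<and> (\<forall>X \<subseteq> FR \<Lambda>. X \<noteq> {} \<longrightarrow> \<gamma> X \<in> X)"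

definition maxichoice_eviction ::
    "('f, 'm) satisfaction_system \<Rightarrow> ('f set \<times> 'm set \<Rightarrow> 'f set) \<Rightarrow> bool" where
  "maxichoice_eviction \<Lambda> ev \<longleftrightarrow>
     (\<exists>\<gamma>. selection_function \<Lambda> \<gamma> \<and>
       (\<forall>B \<in> bases \<Lambda>. \<forall>M \<subseteq> models \<Lambda>.
          Mod \<Lambda> (ev (B, M)) = \<gamma> (FRsubs (Mod \<Lambda> B - M) \<Lambda>)))"

definition success ::
    "('f, 'm) satisfaction_system \<Rightarrow> ('f set \<times> 'm set \<Rightarrow> 'f set) \<Rightarrow> bool" where
  "success \<Lambda> ev \<longleftrightarrow>
     (\<forall>B \<in> bases \<Lambda>. \<forall>M \<subseteq> models \<Lambda>. M \<inter> Mod \<Lambda> (ev (B, M)) = {})"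

definition inclusion ::
    "('f, 'm) satisfaction_system \<Rightarrow> ('f set \<times> 'm set \<Rightarrow> 'f set) \<Rightarrow> bool" where
  "inclusion \<Lambda> ev \<longleftrightarrow>
     (\<forall>B \<in> bases \<Lambda>. \<forall>M \<subseteq> models \<Lambda>. Mod \<Lambda> (ev (B, M)) \<subseteq> Mod \<Lambda> B)"

definition vacuity ::
    "('f, 'm) satisfaction_system \<Rightarrow> ('f set \<times> 'm set \<Rightarrow> 'f set) \<Rightarrow> bool" where
  "vacuity \<Lambda> ev \<longleftrightarrow>
     (\<forall>B \<in> bases \<Lambda>. \<forall>M \<subseteq> models \<Lambda>.
        M \<inter> Mod \<Lambda> B = {} \<longrightarrow> Mod \<Lambda> (ev (B, M)) = Mod \<Lambda> B)"

definition finite_retainment ::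
    "('f, 'm) satisfaction_system \<Rightarrow> ('f set \<times> 'm set \<Rightarrow> 'f set) \<Rightarrow> bool" where
  "finite_retainment \<Lambda> ev \<longleftrightarrow>
     (\<forall>B \<in> bases \<Lambda>. \<forall>M \<subseteq> models \<Lambda>. \<forall>N.
        Mod \<Lambda> (ev (B, M)) \<subset> N \<and> N \<subseteq> Mod \<Lambda> B - M \<longrightarrow> N \<notin> FR \<Lambda>)"

definition uniformity ::
    "('f, 'm) satisfaction_system \<Rightarrow> ('f set \<times> 'm set \<Rightarrow> 'f set) \<Rightarrow> bool" where
  "uniformity \<Lambda> ev \<longleftrightarrow>
     (\<forall>B \<in> bases \<Lambda>. \<forall>B' \<in> bases \<Lambda>. \<forall>M \<subseteq> models \<Lambda>. \<forall>M' \<subseteq> models \<Lambda>.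
        FRsubs (Mod \<Lambda> B - M) \<Lambda> = FRsubs (Mod \<Lambda> B' - M') \<Lambda> \<longrightarrow>
        Mod \<Lambda> (ev (B, M)) = Mod \<Lambda> (ev (B', M')))"

end

theory Submission
  imports Defs
begin

text \<open>Success, inclusion and finite retainment together say exactly that the models of every
  contraction form a maximal finitely representable subset of \<open>Mod \<Lambda> B - M\<close>. Uniformity makes this
  choice a function of the family of these maximal subsets, hence extendable to a selection
  function. Vacuity is a consequence, because a finitely representable set is its own only maximal
  finitely representable subset.\<close>

lemma Mod_in_FR:
  assumes "B \<in> bases \<Lambda>"
  shows "Mod \<Lambda> B \<in> FR \<Lambda>"
  using assms by (auto simp: FR_def Mod_def)

lemma FRsubs_subset_FR: "FRsubs M \<Lambda> \<subseteq> FR \<Lambda>"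
  by (auto simp: FRsubs_def)

lemma FRsubs_of_FR:
  assumes "X \<in> FR \<Lambda>"
  shows "FRsubs X \<Lambda> = {X}"
  using assms by (auto simp: FRsubs_def)

text \<open>Since \<open>ev\<close> returns a base, its outcome has a finitely representable model
  set. What remains of membership in \<open>FRsubs\<close> is disjointness from \<open>M\<close>
  (success), containment in \<open>Mod \<Lambda> B\<close> (inclusion) and maximality (finite
  retainment).\<close>

lemma all_in_FRsubs_iff:
  assumes "model_change_operation \<Lambda> ev"
  shows "(\<forall>B \<in> bases \<Lambda>. \<forall>M \<subseteq> models \<Lambda>. Mod \<Lambda> (ev (B, M)) \<in> FRsubs (Mod \<Lambda> B - M) \<Lambda>) \<longleftrightarrow>
    success \<Lambda> ev \<and> inclusion \<Lambda> ev \<and> finite_retainment \<Lambda> ev"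
proof -
  have "Mod \<Lambda> (ev (B, M)) \<in> FRsubs (Mod \<Lambda> B - M) \<Lambda> \<longleftrightarrow>
      M \<inter> Mod \<Lambda> (ev (B, M)) = {} \<and> Mod \<Lambda> (ev (B, M)) \<subseteq> Mod \<Lambda> B \<and>
      (\<forall>N. Mod \<Lambda> (ev (B, M)) \<subset> N \<and> N \<subseteq> Mod \<Lambda> B - M \<longrightarrow> N \<notin> FR \<Lambda>)"
    if "B \<in> bases \<Lambda>" "M \<subseteq> models \<Lambda>" for B M
  proof -
    have "ev (B, M) \<in> bases \<Lambda>"
      using assms that by (auto simp: model_change_operation_def)
    then have "Mod \<Lambda> (ev (B, M)) \<in> FR \<Lambda>"
      by (rule Mod_in_FR)
    then show ?thesis
      unfolding FRsubs_def by blast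
  qed
  then show ?thesis
    unfolding success_def inclusion_def finite_retainment_def by meson
qed

lemma vacuity_if_in_FRsubs:
  assumes "\<And>B M. B \<in> bases \<Lambda> \<Longrightarrow> M \<subseteq> models \<Lambda> \<Longrightarrow>
    Mod \<Lambda> (ev (B, M)) \<in> FRsubs (Mod \<Lambda> B - M) \<Lambda>"
  shows "vacuity \<Lambda> ev"
  unfolding vacuity_def
proof (intro ballI allI impI)
  fix B M
  assume B: "B \<in> bases \<Lambda>" and M: "M \<subseteq> models \<Lambda>" and "M \<inter> Mod \<Lambda> B = {}"
  then have "Mod \<Lambda> B - M = Mod \<Lambda> B"
    by blast
  then show "Mod \<Lambda> (ev (B, M)) = Mod \<Lambda> B"
    using assms[OF B M] FRsubs_of_FR[OF Mod_in_FR[OF B]] by simp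
qed

text \<open>This trades the existential over selection functions for a condition on
  \<open>ev\<close> alone, to which the previous two lemmas apply.\<close>

lemma maxichoice_eviction_iff:
  assumes "eviction_compatible \<Lambda>"
  shows "maxichoice_eviction \<Lambda> ev \<longleftrightarrow>
    (\<forall>B \<in> bases \<Lambda>. \<forall>M \<subseteq> models \<Lambda>. Mod \<Lambda> (ev (B, M)) \<in> FRsubs (Mod \<Lambda> B - M) \<Lambda>) \<and>
    uniformity \<Lambda> ev"
    (is "_ \<longleftrightarrow> ?chosen \<and> _")
proof
  assume "maxichoice_eviction \<Lambda> ev"
  then obtain \<gamma> where \<gamma>: "selection_function \<Lambda> \<gamma>"
    and ev: "\<And>B M. B \<in> bases \<Lambda> \<Longrightarrow> M \<subseteq> models \<Lambda> \<Longrightarrow>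
      Mod \<Lambda> (ev (B, M)) = \<gamma> (FRsubs (Mod \<Lambda> B - M) \<Lambda>)"
    unfolding maxichoice_eviction_def by blast
  have ?chosen
    \<comment> \<open>Eviction compatibility makes each family
      \<open>FRsubs (Mod \<Lambda> B - M) \<Lambda>\<close> nonempty, so \<gamma> is bound to pick
      one of its members.\<close>
    using assms \<gamma> by (simp add: ev eviction_compatible_def selection_function_def FRsubs_subset_FR)
  moreover have "uniformity \<Lambda> ev"
    by (simp add: uniformity_def ev)
  ultimately show "?chosen \<and> uniformity \<Lambda> ev" ..
next
  assume asm: "?chosen \<and> uniformity \<Lambda> ev"
  \<comment> \<open>The graph of the partial choice that \<open>ev\<close> forces: it relates a
    family to every outcome obtained from some pair \<open>(B, M)\<close> with that family.
    Uniformity makes it single-valued.\<close>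
  define represents where "represents X Z \<longleftrightarrow>
    (\<exists>B \<in> bases \<Lambda>. \<exists>M \<subseteq> models \<Lambda>. X = FRsubs (Mod \<Lambda> B - M) \<Lambda> \<and> Z = Mod \<Lambda> (ev (B, M)))" for X Z
  have unique: "Z = Z'" if "represents X Z" "represents X Z'" for X Z Z'
    using that asm unfolding represents_def uniformity_def by metis
  have mem: "Z \<in> X" if "represents X Z" for X Z
    using that asm unfolding represents_def by blast
  \<comment> \<open>On families arising from \<open>ev\<close> the value is forced; on any other
    nonempty family an arbitrary member is taken.\<close>
  define \<gamma> where "\<gamma> X = (if \<exists>Z. represents X Z then THE Z. represents X Z else SOME Z. Z \<in> X)" for X
  have \<gamma>_eq: "\<gamma> X = Z" if "represents X Z" for X Z
    using that unique by (auto simp: \<gamma>_def intro!: the_equality)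
  \<comment> \<open>For \<open>X \<subseteq> FR \<Lambda>\<close> this also puts the value in
    \<open>FR \<Lambda>\<close>, as the codomain condition on \<gamma> demands.\<close>
  have "\<gamma> X \<in> X" if "X \<noteq> {}" for X
  proof (cases "\<exists>Z. represents X Z")
    case True
    then show ?thesis
      using \<gamma>_eq mem by metis
  next
    case False
    then show ?thesis
      using that by (simp add: \<gamma>_def some_in_eq)
  qed
  then have "selection_function \<Lambda> \<gamma>"
    unfolding selection_function_def by blast
  moreover have "Mod \<Lambda> (ev (B, M)) = \<gamma> (FRsubs (Mod \<Lambda> B - M) \<Lambda>)"
    if "B \<in> bases \<Lambda>" "M \<subseteq> models \<Lambda>" for B M
    using that by (intro \<gamma>_eq[symmetric]) (auto simp: represents_def)
  ultimately show "maxichoice_eviction \<Lambda> ev"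
    unfolding maxichoice_eviction_def by blast
qed

theorem theorem1:
  fixes \<Lambda> :: "('f, 'm) satisfaction_system"
    and ev :: "'f set \<times> 'm set \<Rightarrow> 'f set"
  assumes "eviction_compatible \<Lambda>"
    and "model_change_operation \<Lambda> ev"
  shows "maxichoice_eviction \<Lambda> ev \<longleftrightarrow>
    success \<Lambda> ev \<and> inclusion \<Lambda> ev \<and> vacuity \<Lambda> ev \<and>
    finite_retainment \<Lambda> ev \<and> uniformity \<Lambda> ev"
  using maxichoice_eviction_iff[OF assms(1)] all_in_FRsubs_iff[OF assms(2)]
    vacuity_if_in_FRsubs[of \<Lambda> ev]
  by blast

end
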